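(* Let $\widehat G=(V,E)$ be a finite tadpole-free undirected graph (multiple edges allowed) with $V\neq\emptyset$. Then $$\sum_{G\in\operatorname{Ori}(\widehat G)}\omega_c(G;\boldsymbol\beta)=\sum_{\substack{F\subseteq E\\ (V,F)\ \mathrm{connected}}}(-1)^{|F|}\prod_{u\in E\setminus F}\overline\beta_u .$$ Thus the orientation sum depends on the two directional parameters of each edge only through their average $\overline\beta_u$.
   Context: $\operatorname{Ori}(\widehat G)$ is the set of the $2^{|E|}$ quivers obtained by choosing independently one of the two orientations of every edge of $\widehat G$ (parallel edges are distinct). For $u\in E$ with its two orientations $\varepsilon,\bar\varepsilon$, independent parameters $\beta_\varepsilon,\beta_{\bar\varepsilon}$ are attached and $\overline\beta_u=(\beta_\varepsilon+\beta_{\bar\varepsilon})/2$. In $\omega_c(G;\boldsymbol\beta)$ each oriented edge uses the parameter of its chosen orientation. Definition of $\omega_c$. A (finite) quiver $G=(V_G,E_G,\rho_G)$ has finite sets $V_G,E_G$ and $\rho_G:E_G\to V_G\times V_G$, where $\rho_G(\varepsilon)=(u,v)$ is written $\varepsilon:u\to v$; parallel edges, directed cycles and tadpoles (edges $u\to u$) are allowed; acyclic means no directed cycle (tadpoles count as directed cycles); connected means nonempty with connected underlying undirected graph. Edges carry parameters $\beta_\varepsilon$ over a field of characteristic zero, kept by edges surviving in subquivers/contractions; $\beta_{\varepsilon,\pm}=(\beta_\varepsilon\pm1)/2$. A cut-subquiver $H\preceq G$ has vertex set $V_G$ and any $E_H\subseteq E_G$; the contraction $G/H$ has vertices the connected components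 of $H$ and edges $E_G\setminus E_H$ with induced incidences. For tadpole-free $G$, $e_0(G)=|\operatorname{LE}(G)|/|V_G|!$ if $G$ is acyclic ($\operatorname{LE}(G)$ = linear extensions of the partial order induced by the edges), $e_0(G)=0$ otherwise; in general $e(G;\boldsymbol\beta)=\bigl(\prod_{\varepsilon\text{ tadpole}}(-\beta_{\varepsilon,-})\bigr)e_0(G_{\mathrm{pruned}})$ with $G_{\mathrm{pruned}}$ obtained by deleting all tadpoles. $\omega$ is the unique function on quivers with $\sum_{H\preceq G}\omega(H)e(G/H)=\epsilon(G)$, $\epsilon(G)=1$ if $E_G=\emptyset$ and $0$ otherwise; $\omega_c(G)=\omega(G)$ for connected $G$, and $\omega_c(G)=0$ otherwise. *)

theory Defs
  imports Complex_Main "HOL-Library.FuncSet" "Graph_Theory.Digraph_Component"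
begin

section \<open>Quivers, contraction and the function \<open>e\<close>\<close>

text \<open>
  A finite quiver is a \<^typ>\<open>('v, 'e) pre_digraph\<close> satisfying \<^locale>\<open>fin_digraph\<close>
  (parallel arcs and loops are allowed, the vertex set may be empty).  Its cut-subquivers are the
  graphs \<open>H\<close> with \<^term>\<open>spanning H G\<close>.  Edge parameters are a function \<open>\<beta>\<close> on the type of edge
  names, so the edges that survive in a subquiver or a contraction keep their parameters.
\<close>

definition wcc_of :: "('v, 'e) pre_digraph \<Rightarrow> 'v \<Rightarrow> 'v set" where
  "wcc_of H v = {w. v \<rightarrow>\<^sup>*\<^bsub>mk_symmetric H\<^esub> w}"

definition contract :: "('v, 'e) pre_digraph \<Rightarrow> ('v, 'e) pre_digraph \<Rightarrow> ('v set, 'e) pre_digraph" where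
  "contract G H =
     \<lparr>verts = wcc_of H ` verts H, arcs = arcs G - arcs H,
      tail = (\<lambda>a. wcc_of H (tail G a)), head = (\<lambda>a. wcc_of H (head G a))\<rparr>"

definition acyclic_quiver :: "('v, 'e) pre_digraph \<Rightarrow> bool" where
  "acyclic_quiver G \<longleftrightarrow> acyclic (arcs_ends G)"

definition induced_order :: "('v, 'e) pre_digraph \<Rightarrow> 'v rel" where
  "induced_order G = {(u, v). u \<rightarrow>\<^sup>*\<^bsub>G\<^esub> v}"

definition LE :: "('v, 'e) pre_digraph \<Rightarrow> 'v rel set" where
  "LE G = {r. linear_order_on (verts G) r \<and> induced_order G \<subseteq> r}"

definition e0 :: "('v, 'e) pre_digraph \<Rightarrow> 'k :: field_char_0" where
  "e0 G = (if acyclic_quiver G then of_nat (card (LE G)) / fact (card (verts G)) else 0)"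

definition tadpoles :: "('v, 'e) pre_digraph \<Rightarrow> 'e set" where
  "tadpoles G = {a \<in> arcs G. tail G a = head G a}"

definition pruned :: "('v, 'e) pre_digraph \<Rightarrow> ('v, 'e) pre_digraph" where
  "pruned G = G\<lparr>arcs := arcs G - tadpoles G\<rparr>"

definition e_quiver :: "('e \<Rightarrow> 'k :: field_char_0) \<Rightarrow> ('v, 'e) pre_digraph \<Rightarrow> 'k" where
  "e_quiver \<beta> G = (\<Prod>a\<in>tadpoles G. - ((\<beta> a - 1) / 2)) * e0 (pruned G)"

section \<open>The function \<open>\<omega>\<close>\<close>

definition counit :: "('v, 'e) pre_digraph \<Rightarrow> 'k :: field_char_0" where
  "counit G = (if arcs G = {} then 1 else 0)"

text \<open>
  HOL functions are total, so \<open>\<omega>\<close> is pinned to 0 on records that are not finite quivers; without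
  this it would not be unique.
\<close>

definition is_omega :: "('e \<Rightarrow> 'k :: field_char_0) \<Rightarrow> (('v, 'e) pre_digraph \<Rightarrow> 'k) \<Rightarrow> bool" where
  "is_omega \<beta> w \<longleftrightarrow>
     (\<forall>G. fin_digraph G \<longrightarrow>
        (\<Sum>H | spanning H G. w H * e_quiver \<beta> (contract G H)) = counit G) \<and>
     (\<forall>G. \<not> fin_digraph G \<longrightarrow> w G = 0)"

definition omega :: "('e \<Rightarrow> 'k :: field_char_0) \<Rightarrow> ('v, 'e) pre_digraph \<Rightarrow> 'k" where
  "omega \<beta> = (THE w. is_omega \<beta> w)"

definition omega_c :: "('e \<Rightarrow> 'k :: field_char_0) \<Rightarrow> ('v, 'e) pre_digraph \<Rightarrow> 'k" where
  "omega_c \<beta> G = (if connected G then omega \<beta> G else 0)"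

subsection \<open>Existence and uniqueness of \<open>\<omega>\<close>\<close>

lemma linear_order_on_top:
  assumes "finite V" "V \<noteq> {}" "linear_order_on V r"
  obtains x where "x \<in> V" "\<And>y. y \<in> V \<Longrightarrow> (y, x) \<in> r"
proof -
  have r: "refl_on V r" "trans r" "total_on V r"
    using assms(3) by (auto simp: order_on_defs)
  have "\<exists>x\<in>A. \<forall>y\<in>A. (y, x) \<in> r" if "finite A" "A \<noteq> {}" "A \<subseteq> V" for A
    using that
  proof (induction A rule: finite_ne_induct)
    case (singleton x)
    then show ?case using r(1) by (auto simp: refl_on_def)
  next
    case (insert x F)
    then obtain m where m: "m \<in> F" "\<forall>y\<in>F. (y, m) \<in> r" by auto
    have mV: "m \<in> V" "x \<in> V" "(x, x) \<in> r"
      using insert.prems m r(1) by (auto simp: refl_on_def)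
    show ?case
    proof (cases "(x, m) \<in> r")
      case True
      then show ?thesis using m by auto
    next
      case False
      then have "(m, x) \<in> r" using mV r(3) by (auto simp: total_on_def)
      then have "\<forall>y\<in>insert x F. (y, x) \<in> r"
        using m(2) mV(3) r(2) by (auto dest: transD)
      then show ?thesis by auto
    qed
  qed
  from this[of V] assms that show thesis by auto
qed

lemma finite_linear_orders: "finite V \<Longrightarrow> finite {r. linear_order_on V r}"
  by (rule finite_subset[of _ "Pow (V \<times> V)"]) (auto simp: order_on_defs)

lemma card_linear_orders:
  assumes "finite V"
  shows "card {r. linear_order_on V r} = fact (card V)"
  using assms
proof (induction "card V" arbitrary: V)
  case 0
  then have "{r. linear_order_on V r} = {{}}" by (auto simp: order_on_defs)
  then show ?case using 0 by simp
next
  case (Suc n)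
  define L where "L = (\<lambda>V :: 'a set. {r. linear_order_on V r})"
  define X where "X = (\<lambda>x (r :: 'a rel). r \<union> V \<times> {x})"
  have ne: "V \<noteq> {}" using Suc.hyps(2) by auto
  have sub: "r \<subseteq> (V - {x}) \<times> (V - {x})" if "r \<in> L (V - {x})" for r x
    using that by (auto simp: L_def order_on_defs)
  have eq: "L V = (\<Union>x\<in>V. X x ` L (V - {x}))"
  proof (intro equalityI subsetI)
    fix r assume "r \<in> L V"
    then have r: "linear_order_on V r" by (simp add: L_def)
    obtain x where x: "x \<in> V" "\<And>y. y \<in> V \<Longrightarrow> (y, x) \<in> r"
      using linear_order_on_top[OF Suc.prems ne r] by blast
    define s where "s = r \<inter> (V - {x}) \<times> (V - {x})"
    have "s \<in> L (V - {x})"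
      using r unfolding L_def s_def order_on_defs refl_on_def trans_def antisym_def total_on_def
      by blast
    moreover have "r = X x s"
    proof -
      have "r \<subseteq> V \<times> V" "antisym r" using r by (auto simp: order_on_defs)
      then show ?thesis using x unfolding X_def s_def antisym_def by blast
    qed
    ultimately show "r \<in> (\<Union>x\<in>V. X x ` L (V - {x}))" using x(1) by blast
  next
    fix r assume "r \<in> (\<Union>x\<in>V. X x ` L (V - {x}))"
    then obtain x s where xs: "x \<in> V" "s \<in> L (V - {x})" "r = X x s" by blast
    have s: "s \<subseteq> (V - {x}) \<times> (V - {x})" using sub[OF xs(2)] .
    have s': "refl_on (V - {x}) s" "trans s" "antisym s" "total_on (V - {x}) s"
      using xs(2) by (auto simp: L_def order_on_defs)
    have "refl_on V r" using s'(1) xs by (auto simp: X_def refl_on_def)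
    moreover have "trans r"
      unfolding xs(3) X_def trans_def using s s'(2) xs(1) by (blast dest: transD)
    moreover have "antisym r"
      unfolding xs(3) X_def antisym_def using s s'(3) xs(1) by (blast dest: antisymD)
    moreover have "total_on V r"
      unfolding xs(3) X_def total_on_def using s'(4) xs(1) by (auto simp: total_on_def)
    moreover have "r \<subseteq> V \<times> V" using s xs by (auto simp: X_def)
    ultimately show "r \<in> L V" by (simp add: L_def order_on_defs)
  qed
  have inj: "inj_on (X x) (L (V - {x}))" for x
  proof (rule inj_onI)
    fix r s assume "r \<in> L (V - {x})" "s \<in> L (V - {x})" "X x r = X x s"
    then show "r = s" using sub[of r x] sub[of s x] unfolding X_def by blast
  qed
  have disj: "X x ` L (V - {x}) \<inter> X y ` L (V - {y}) = {}" if "x \<in> V" "y \<in> V" "x \<noteq> y" for x y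
  proof -
    have False if "r \<in> L (V - {x})" "s \<in> L (V - {y})" "X x r = X y s" for r s
    proof -
      have "(x, y) \<in> X y s" using \<open>x \<in> V\<close> by (auto simp: X_def)
      then have "(x, y) \<in> X x r" using that(3) by simp
      then show False using sub[OF that(1)] \<open>x \<noteq> y\<close> by (auto simp: X_def)
    qed
    then show ?thesis by blast
  qed
  have fin: "finite (L (V - {x}))" for x
    using Suc.prems finite_linear_orders[of "V - {x}"] by (simp add: L_def)
  have "card (L V) = (\<Sum>x\<in>V. card (X x ` L (V - {x})))"
    unfolding eq by (rule card_UN_disjoint) (use Suc.prems fin disj in auto)
  also have "\<dots> = (\<Sum>x\<in>V. fact n)"
  proof (rule sum.cong[OF refl])
    fix x assume x: "x \<in> V"
    then have c: "card (V - {x}) = n" using Suc.hyps(2) Suc.prems by simp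
    have "card (L (V - {x})) = fact n"
      unfolding L_def using Suc.hyps(1)[of "V - {x}"] c Suc.prems by simp
    then show "card (X x ` L (V - {x})) = fact n"
      by (simp add: card_image[OF inj])
  qed
  also have "\<dots> = fact (card V)" using Suc.hyps(2)[symmetric] by simp
  finally show ?case by (simp add: L_def)
qed

lemma e_quiver_arcless:
  assumes "finite (verts G)" "arcs G = {}"
  shows "e_quiver \<beta> G = 1"
proof -
  have P: "pruned G = G" "tadpoles G = {}"
    using assms by (auto simp: pruned_def tadpoles_def)
  have "arcs_ends G = {}" using assms by (simp add: arcs_ends_def)
  then have "induced_order G = Id_on (verts G)"
    by (auto simp: induced_order_def reachable_def Id_on_def elim: rtrancl_on.cases)
  then have "LE G = {r. linear_order_on (verts G) r}"
    by (auto simp: LE_def order_on_defs refl_on_def)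
  then have "card (LE G) = fact (card (verts G))"
    using card_linear_orders[OF assms(1)] by simp
  moreover have "acyclic_quiver G"
    using \<open>arcs_ends G = {}\<close> by (simp add: acyclic_quiver_def acyclic_def)
  ultimately show ?thesis by (simp add: e_quiver_def P e0_def)
qed

lemma spanning_iff:
  assumes "fin_digraph G"
  shows "spanning H G \<longleftrightarrow> (\<exists>F\<subseteq>arcs G. H = G\<lparr>arcs := F\<rparr>)"
proof -
  interpret fin_digraph G by fact
  have wf: "wf_digraph (G\<lparr>arcs := F\<rparr>)" if "F \<subseteq> arcs G" for F
    using that by unfold_locales auto
  show ?thesis
  proof
    assume "spanning H G"
    then show "\<exists>F\<subseteq>arcs G. H = G\<lparr>arcs := F\<rparr>"
      by (intro exI[of _ "arcs H"]) (auto simp: spanning_def subgraph_def compatible_def)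
  next
    assume "\<exists>F\<subseteq>arcs G. H = G\<lparr>arcs := F\<rparr>"
    then show "spanning H G"
      using wf wf_digraph by (auto simp: spanning_def subgraph_def compatible_def)
  qed
qed

lemma finite_spanning: "fin_digraph G \<Longrightarrow> finite {H. spanning H G}"
proof -
  assume G: "fin_digraph G"
  have "{H. spanning H G} = (\<lambda>F. G\<lparr>arcs := F\<rparr>) ` Pow (arcs G)"
    using spanning_iff[OF G] by auto
  then show ?thesis using fin_digraph.finite_arcs[OF G] by simp
qed

lemma spanning_refl: "fin_digraph G \<Longrightarrow> spanning G G"
  by (auto simp: spanning_iff intro: exI[of _ "arcs G"])

lemma spanning_card_less:
  assumes "fin_digraph G" "spanning H G" "H \<noteq> G"
  shows "card (arcs H) < card (arcs G)"
proof -
  obtain F where "F \<subseteq> arcs G" "H = G\<lparr>arcs := F\<rparr>"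
    using assms spanning_iff by blast
  moreover from this have "F \<noteq> arcs G" using assms(3) by auto
  ultimately show ?thesis
    using fin_digraph.finite_arcs[OF assms(1)] by (auto intro: psubset_card_mono)
qed

lemma omega_sum_split:
  fixes \<beta> :: "'e \<Rightarrow> 'k :: field_char_0" and G :: "('v, 'e) pre_digraph"
  assumes "fin_digraph G"
  shows "(\<Sum>H | spanning H G. w H * e_quiver \<beta> (contract G H)) =
    w G + (\<Sum>H | spanning H G \<and> H \<noteq> G. w H * e_quiver \<beta> (contract G H))"
proof -
  have "e_quiver \<beta> (contract G G) = 1"
    using fin_digraph.finite_verts[OF assms]
    by (intro e_quiver_arcless) (auto simp: contract_def)
  moreover have "{H. spanning H G \<and> H \<noteq> G} = {H. spanning H G} - {G}" by auto
  ultimately show ?thesis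
    using sum.remove[OF finite_spanning[OF assms], of G "\<lambda>H. w H * e_quiver \<beta> (contract G H)"]
      spanning_refl[OF assms] by simp
qed

function omega_rec :: "('e \<Rightarrow> 'k :: field_char_0) \<Rightarrow> ('v, 'e) pre_digraph \<Rightarrow> 'k" where
  "omega_rec \<beta> G =
    (if fin_digraph G then counit G -
       (\<Sum>H\<in>{H. spanning H G \<and> H \<noteq> G}. omega_rec \<beta> H * e_quiver \<beta> (contract G H))
     else 0)"
  by auto
termination
  by (relation "measure (\<lambda>(\<beta>, G). card (arcs G))") (auto intro: spanning_card_less)

declare omega_rec.simps [simp del]

theorem ex1_is_omega:
  fixes \<beta> :: "'e \<Rightarrow> 'k :: field_char_0"
  shows "\<exists>!w :: ('v, 'e) pre_digraph \<Rightarrow> 'k. is_omega \<beta> w"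
proof (rule ex1I)
  show "is_omega \<beta> (omega_rec \<beta> :: ('v, 'e) pre_digraph \<Rightarrow> 'k)"
    unfolding is_omega_def
    by (auto simp: omega_sum_split omega_rec.simps[where \<beta> = \<beta>])
next
  fix w :: "('v, 'e) pre_digraph \<Rightarrow> 'k" assume w: "is_omega \<beta> w"
  have "w G = omega_rec \<beta> G" for G
  proof (induction "card (arcs G)" arbitrary: G rule: less_induct)
    case less
    show ?case
    proof (cases "fin_digraph G")
      case True
      then have "w G = counit G -
          (\<Sum>H\<in>{H. spanning H G \<and> H \<noteq> G}. w H * e_quiver \<beta> (contract G H))"
        using w omega_sum_split[OF True, of w \<beta>] by (simp add: is_omega_def algebra_simps)
      also have "\<dots> = omega_rec \<beta> G"
        using True less spanning_card_less[OF True]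
        by (subst omega_rec.simps) (auto intro!: sum.cong)
      finally show ?thesis .
    next
      case False
      then show ?thesis using w by (simp add: is_omega_def omega_rec.simps)
    qed
  qed
  then show "w = omega_rec \<beta>" by auto
qed

corollary is_omega_omega: "is_omega \<beta> (omega \<beta>)"
  unfolding omega_def by (rule theI'[OF ex1_is_omega])

section \<open>Orientations of undirected multigraphs\<close>

text \<open>
  An undirected multigraph is given by a vertex set \<open>V\<close>, a set \<open>E\<close> of edge names and the map \<open>ends\<close>
  from edges to their sets of end points.  An oriented edge is a triple \<open>(u, x, y)\<close>: the edge \<open>u\<close>
  directed from \<open>x\<close> to \<open>y\<close>.  These triples are the arc names of the orientations, so that
  \<open>\<beta> (u, x, y)\<close> and \<open>\<beta> (u, y, x)\<close> are independent.
\<close>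

definition tadpole_free_multigraph :: "'v set \<Rightarrow> 'u set \<Rightarrow> ('u \<Rightarrow> 'v set) \<Rightarrow> bool" where
  "tadpole_free_multigraph V E ends \<longleftrightarrow>
     finite V \<and> finite E \<and> (\<forall>u\<in>E. ends u \<subseteq> V \<and> card (ends u) = 2)"

definition multigraph_connected :: "'v set \<Rightarrow> 'u set \<Rightarrow> ('u \<Rightarrow> 'v set) \<Rightarrow> bool" where
  "multigraph_connected V F ends \<longleftrightarrow>
     V \<noteq> {} \<and> (\<forall>x\<in>V. \<forall>y\<in>V. (x, y) \<in> {(a, b). \<exists>u\<in>F. ends u = {a, b}}\<^sup>*)"

definition edge_orientations :: "('u \<Rightarrow> 'v set) \<Rightarrow> 'u \<Rightarrow> ('u \<times> 'v \<times> 'v) set" where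
  "edge_orientations ends u = {(u, x, y) | x y. ends u = {x, y}}"

definition Ori :: "'v set \<Rightarrow> 'u set \<Rightarrow> ('u \<Rightarrow> 'v set) \<Rightarrow> ('v, 'u \<times> 'v \<times> 'v) pre_digraph set" where
  "Ori V E ends =
     {\<lparr>verts = V, arcs = c ` E, tail = (\<lambda>(u, x, y). x), head = (\<lambda>(u, x, y). y)\<rparr>
       | c. \<forall>u\<in>E. c u \<in> edge_orientations ends u}"

definition beta_avg ::
    "('u \<Rightarrow> 'v set) \<Rightarrow> ('u \<times> 'v \<times> 'v \<Rightarrow> 'k :: field_char_0) \<Rightarrow> 'u \<Rightarrow> 'k" where
  "beta_avg ends \<beta> u = (\<Sum>\<epsilon>\<in>edge_orientations ends u. \<beta> \<epsilon>) / 2"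

lemma card_edge_orientations:
  assumes "card (ends u) = 2"
  shows "card (edge_orientations ends u) = 2"
proof -
  obtain x y where xy: "ends u = {x, y}" "x \<noteq> y"
    using assms by (auto simp: card_2_iff)
  then have "edge_orientations ends u = {(u, x, y), (u, y, x)}"
    by (auto simp: edge_orientations_def doubleton_eq_iff)
  then show ?thesis using xy by simp
qed

lemma fin_digraph_Ori:
  assumes "tadpole_free_multigraph V E ends" "G \<in> Ori V E ends"
  shows "fin_digraph G"
proof -
  obtain c where c: "\<forall>u\<in>E. c u \<in> edge_orientations ends u" and G:
    "G = \<lparr>verts = V, arcs = c ` E, tail = (\<lambda>(u, x, y). x), head = (\<lambda>(u, x, y). y)\<rparr>"
    using assms(2) by (auto simp: Ori_def)
  have "fst (snd (c u)) \<in> V \<and> snd (snd (c u)) \<in> V" if uE: "u \<in> E" for u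
  proof -
    obtain x y where "c u = (u, x, y)" "ends u = {x, y}"
      using c uE unfolding edge_orientations_def by blast
    then show ?thesis using assms(1) uE by (auto simp: tadpole_free_multigraph_def)
  qed
  then show ?thesis
    using assms(1) unfolding G
    by unfold_locales (auto simp: tadpole_free_multigraph_def case_prod_beta)
qed

lemma card_Ori:
  assumes "tadpole_free_multigraph V E ends"
  shows "card (Ori V E ends) = 2 ^ card E"
proof -
  let ?mk = "\<lambda>c. \<lparr>verts = V, arcs = c ` E,
    tail = (\<lambda>(u, x, y). x), head = (\<lambda>(u, x, y). y)\<rparr> :: ('a, 'b \<times> 'a \<times> 'a) pre_digraph"
  let ?C = "Pi\<^sub>E E (edge_orientations ends)"
  have fst_c: "fst (c u) = u" if "c \<in> ?C" "u \<in> E" for c u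
    using that by (auto simp: edge_orientations_def PiE_def Pi_def)
  have "Ori V E ends = ?mk ` ?C"
  proof (intro equalityI subsetI)
    fix G assume "G \<in> Ori V E ends"
    then obtain c where "\<forall>u\<in>E. c u \<in> edge_orientations ends u" "G = ?mk c"
      by (auto simp: Ori_def)
    then show "G \<in> ?mk ` ?C" by (intro image_eqI[of _ _ "restrict c E"]) auto
  qed (auto simp: Ori_def)
  moreover have "inj_on ?mk ?C"
  proof (rule inj_onI)
    fix c d assume cd: "c \<in> ?C" "d \<in> ?C" "?mk c = ?mk d"
    have "c u = d u" if "u \<in> E" for u
    proof -
      have "c u \<in> d ` E" using cd(3) that by auto
      then show ?thesis using fst_c[OF cd(1) that] fst_c[OF cd(2)] by force
    qed
    then show "c = d" using cd by (auto intro: PiE_ext)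
  qed
  ultimately have "card (Ori V E ends) = card ?C" by (simp add: card_image)
  also have "\<dots> = 2 ^ card E"
    using assms by (simp add: card_PiE tadpole_free_multigraph_def card_edge_orientations)
  finally show ?thesis .
qed

end

theory Submission
  imports Defs
begin

text \<open>
  Write \<open>b u\<close> for the average parameter of an edge \<open>u\<close>, and let \<open>W F\<close> be the sum of \<open>\<omega>\<close> over all
  orientations of the spanning subgraph \<open>(V, F)\<close>.

  The recursion that defines \<open>\<omega>\<close> is summed over all orientations of \<open>(V, E)\<close>.  A cut-subquiver
  of an orientation is an oriented \<open>(V, F)\<close> with \<open>F \<subseteq> E\<close>, and its contraction is an orientation of
  the graph with edge set \<open>E - F\<close> on the components of \<open>(V, F)\<close>.  Summing \<open>e\<close> over these
  orientations is easy: an edge that becomes a tadpole contributes the sum \<open>1 - b u\<close> of its two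
  values, while the values of \<open>e0\<close> add up to 1, because every linear order on the vertices
  extends exactly one orientation of a tadpole-free graph (lemma \<open>sum_e_quiver\<close>).  Hence the sum
  of \<open>W F * (\<Prod>u. 1 - b u)\<close> over all \<open>F \<subseteq> E\<close> is 1 if \<open>E\<close> is empty and 0 otherwise, the product
  being over the edges of \<open>E - F\<close> with both ends in one component of \<open>(V, F)\<close> (lemma
  \<open>ori_omega_recursion\<close>).

  This recursion determines \<open>W\<close>, and its solution is
  \<open>W E = (\<Sum>K. (- 1) ^ card K * (\<Prod>u\<in>E - K. b u))\<close>, where \<open>K\<close> ranges over the
  subsets of \<open>E\<close> with the same components as \<open>E\<close>.  Indeed, insert this expression for \<open>W F\<close> and fix \<open>K\<close>: then \<open>F\<close> arises from \<open>K\<close> by adding some of the edges inside the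
  components of \<open>K\<close>, so that each of these edges contributes \<open>b u + (1 - b u) = 1\<close>, and
  what remains is the sum of \<open>(-1) ^ card K\<close> over all \<open>K \<subseteq> E\<close> (lemma
  \<open>rank_sum_recursion\<close>).  If \<open>(V, E)\<close> is connected, \<open>K\<close> has the same components as \<open>E\<close> exactly when
  \<open>(V, K)\<close> is connected; otherwise both sides of the theorem vanish.
\<close>

section \<open>Sums over subsets and over families of choices\<close>

lemma bij_betw_PiE_Un:
  assumes "A \<inter> B = {}"
  shows "bij_betw (\<lambda>c. (restrict c A, restrict c B)) (Pi\<^sub>E (A \<union> B) S) (Pi\<^sub>E A S \<times> Pi\<^sub>E B S)"
proof (rule bij_betwI)
  let ?g = "\<lambda>(c, d) u. if u \<in> A then c u else d u"
  show "?g \<in> Pi\<^sub>E A S \<times> Pi\<^sub>E B S \<rightarrow> Pi\<^sub>E (A \<union> B) S"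
    by (auto simp: PiE_def extensional_def)
  show "?g (restrict c A, restrict c B) = c" if "c \<in> Pi\<^sub>E (A \<union> B) S" for c
    using that by (auto simp: PiE_def extensional_def)
  show "(restrict (?g y) A, restrict (?g y) B) = y" if "y \<in> Pi\<^sub>E A S \<times> Pi\<^sub>E B S" for y
    using that assms by (auto simp: PiE_def extensional_def fun_eq_iff)
qed auto

lemma sum_PiE_Un:
  fixes f g :: "('a \<Rightarrow> 'b) \<Rightarrow> 'c :: comm_semiring_0"
  assumes "A \<inter> B = {}"
  shows "(\<Sum>c\<in>Pi\<^sub>E (A \<union> B) S. f (restrict c A) * g (restrict c B)) =
    (\<Sum>c\<in>Pi\<^sub>E A S. f c) * (\<Sum>d\<in>Pi\<^sub>E B S. g d)"
  using sum.reindex_bij_betw[OF bij_betw_PiE_Un[OF assms, of S], of "\<lambda>(c, d). f c * g d"]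
  by (simp add: sum_product sum.cartesian_product)

lemma subset_recursion_unique:
  fixes w w' :: "'u set \<Rightarrow> 'k :: comm_ring_1" and g :: "'u set \<Rightarrow> 'u set \<Rightarrow> 'k"
  assumes "finite E" and g: "\<And>A. A \<subseteq> E \<Longrightarrow> g A A = 1"
    and eq: "\<And>A. A \<subseteq> E \<Longrightarrow> (\<Sum>F\<in>Pow A. w F * g A F) = (\<Sum>F\<in>Pow A. w' F * g A F)"
  shows "w E = w' E"
  using assms
proof (induction E rule: finite_psubset_induct)
  case (psubset E)
  have "w F = w' F" if "F \<in> Pow E - {E}" for F
    using that by (intro psubset.IH psubset.prems) auto
  then have "(\<Sum>F\<in>Pow E - {E}. w F * g E F) = (\<Sum>F\<in>Pow E - {E}. w' F * g E F)"
    by simp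
  moreover have "(\<Sum>F\<in>Pow E. h F * g E F) = h E + (\<Sum>F\<in>Pow E - {E}. h F * g E F)" for h
    using psubset.hyps psubset.prems(1)[of E] by (subst sum.remove[of _ E]) auto
  ultimately show ?case using psubset.prems(2)[of E] by simp
qed

lemma sum_minus_one_power_card:
  assumes "finite E"
  shows "(\<Sum>K\<in>Pow E. (- 1) ^ card K) = (if E = {} then 1 else (0 :: 'k :: comm_ring_1))"
  using prod_add[OF assms, of "\<lambda>_. - 1 :: 'k" "\<lambda>_. 1"] assms by (simp add: power_0_left)

section \<open>Summing \<open>e\<close> over orientations\<close>

text \<open>For a loopless quiver, acyclicity is implied by the existence of a linear extension.\<close>

lemma e0_loopless:
  fixes G :: "('w, 'e) pre_digraph"
  assumes G: "fin_digraph G" and "tadpoles G = {}"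
  shows "(e0 G :: 'k :: field_char_0) =
    of_nat (card {r. linear_order_on (verts G) r \<and> arcs_ends G \<subseteq> r}) / fact (card (verts G))"
proof -
  interpret fin_digraph G by fact
  have irr: "(x, x) \<notin> arcs_ends G" for x
    using assms(2) by (auto simp: tadpoles_def arcs_ends_conv)
  have ac: "acyclic_quiver G" if r: "linear_order_on (verts G) r" "arcs_ends G \<subseteq> r" for r
  proof -
    have "trans r" "antisym r" using r by (auto simp: order_on_defs)
    then have "trans (r - Id)" by (rule trans_diff_Id)
    then have "acyclic (r - Id)" by (simp add: acyclic_def)
    moreover have "arcs_ends G \<subseteq> r - Id" using r irr by auto
    ultimately show ?thesis unfolding acyclic_quiver_def by (rule acyclic_subset)
  qed
  have LE: "r \<in> LE G \<longleftrightarrow> linear_order_on (verts G) r \<and> arcs_ends G \<subseteq> r" for r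
  proof -
    have "induced_order G \<subseteq> r"
      if r: "linear_order_on (verts G) r" and sub: "arcs_ends G \<subseteq> r"
    proof -
      have tr: "trans r" "refl_on (verts G) r" using r by (auto simp: order_on_defs)
      have "(u, v) \<in> r" if "u \<rightarrow>\<^sup>*\<^bsub>G\<^esub> v" for u v
        using that
      proof (induction rule: reachable_induct)
        case base
        then show ?case using tr by (auto simp: refl_on_def)
      next
        case (step x y)
        then show ?case using tr sub by (blast dest: transD)
      qed
      then show ?thesis by (auto simp: induced_order_def)
    qed
    moreover have "arcs_ends G \<subseteq> induced_order G" by (auto simp: induced_order_def)
    ultimately show ?thesis unfolding LE_def by blast
  qed
  show ?thesis
  proof (cases "acyclic_quiver G")
    case True
    moreover have "LE G = {r. linear_order_on (verts G) r \<and> arcs_ends G \<subseteq> r}" using LE by blast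
    ultimately show ?thesis by (simp add: e0_def)
  next
    case False
    then have "{r. linear_order_on (verts G) r \<and> arcs_ends G \<subseteq> r} = {}" using ac by auto
    then show ?thesis using False by (simp add: e0_def del: Collect_empty_eq)
  qed
qed

text \<open>
  The image under a vertex map \<open>p\<close> of the quiver with the oriented edges \<open>c u\<close> for \<open>u \<in> T\<close>.  With
  \<open>p\<close> the identity this is an orientation, with \<open>p\<close> the map to components a contraction
  of one.
\<close>

definition oriented_quiver ::
    "('v \<Rightarrow> 'w) \<Rightarrow> 'w set \<Rightarrow> 'u set \<Rightarrow> ('u \<Rightarrow> 'u \<times> 'v \<times> 'v) \<Rightarrow> ('w, 'u \<times> 'v \<times> 'v) pre_digraph" where
  "oriented_quiver p W T c =
     \<lparr>verts = W, arcs = c ` T, tail = (\<lambda>(u, x, y). p x), head = (\<lambda>(u, x, y). p y)\<rparr>"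

lemma oriented_quiver_sel [simp]:
  "verts (oriented_quiver p W T c) = W"
  "arcs (oriented_quiver p W T c) = c ` T"
  "tail (oriented_quiver p W T c) (u, x, y) = p x"
  "head (oriented_quiver p W T c) (u, x, y) = p y"
  by (auto simp: oriented_quiver_def)

lemma oriented_quiver_cong:
  "(\<And>u. u \<in> T \<Longrightarrow> c u = d u) \<Longrightarrow> oriented_quiver p W T c = oriented_quiver p W T d"
  by (auto simp: oriented_quiver_def)

lemma edge_orientations_pair:
  assumes "card (ends u) = 2"
  obtains x y where "x \<noteq> y" "ends u = {x, y}" "edge_orientations ends u = {(u, x, y), (u, y, x)}"
proof -
  obtain x y where "ends u = {x, y}" "x \<noteq> y"
    using assms by (auto simp: card_2_iff)
  moreover from this have "edge_orientations ends u = {(u, x, y), (u, y, x)}"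
    by (auto simp: edge_orientations_def doubleton_eq_iff)
  ultimately show thesis using that by blast
qed

lemma PiE_orientationsE:
  assumes "c \<in> Pi\<^sub>E T (edge_orientations ends)" "u \<in> T"
  obtains x y where "c u = (u, x, y)" "ends u = {x, y}"
proof -
  have "c u \<in> edge_orientations ends u" using assms by (rule PiE_mem)
  then show thesis using that by (auto simp: edge_orientations_def)
qed

lemma inj_on_orientation: "c \<in> Pi\<^sub>E T (edge_orientations ends) \<Longrightarrow> inj_on c T"
  by (rule inj_onI) (metis PiE_orientationsE prod.inject)

lemma finite_edge_orientations:
  assumes "card (ends u) = 2"
  shows "finite (edge_orientations ends u)"
  by (rule edge_orientations_pair[of ends u]) (use assms in auto)

lemma fin_digraph_oriented_quiver:
  assumes "finite W" "finite T" "\<And>u x. u \<in> T \<Longrightarrow> x \<in> ends u \<Longrightarrow> p x \<in> W"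
    and c: "c \<in> Pi\<^sub>E T (edge_orientations ends)"
  shows "fin_digraph (oriented_quiver p W T c)"
proof
  fix e assume "e \<in> arcs (oriented_quiver p W T c)"
  then obtain u where u: "u \<in> T" "e = c u" by auto
  then obtain x y where "e = (u, x, y)" "ends u = {x, y}"
    using c by (auto elim: PiE_orientationsE)
  then show "tail (oriented_quiver p W T c) e \<in> verts (oriented_quiver p W T c)"
    "head (oriented_quiver p W T c) e \<in> verts (oriented_quiver p W T c)"
    using assms(3) u by auto
qed (use assms in auto)

text \<open>
  Every linear order on the vertices is a linear extension of exactly one orientation, so the
  orientations share out all \<open>fact (card W)\<close> of them.
\<close>

lemma sum_e0_orientations:
  fixes ends :: "'u \<Rightarrow> 'v set" and p :: "'v \<Rightarrow> 'w"
  assumes fin: "finite W" "finite T" and two: "\<And>u. u \<in> T \<Longrightarrow> card (ends u) = 2"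
    and W: "\<And>u x. u \<in> T \<Longrightarrow> x \<in> ends u \<Longrightarrow> p x \<in> W"
    and inj: "\<And>u. u \<in> T \<Longrightarrow> inj_on p (ends u)"
  shows "(\<Sum>c\<in>Pi\<^sub>E T (edge_orientations ends). e0 (oriented_quiver p W T c)) = (1 :: 'k :: field_char_0)"
proof -
  let ?D = "Pi\<^sub>E T (edge_orientations ends)" and ?L = "{r. linear_order_on W r}"
  define ok where "ok = (\<lambda>(c :: 'u \<Rightarrow> 'u \<times> 'v \<times> 'v) r.
    \<forall>u\<in>T. (p (fst (snd (c u))), p (snd (snd (c u)))) \<in> r)"
  have finD: "finite ?D" using fin two by (intro finite_PiE finite_edge_orientations)
  have finL: "finite ?L" using fin(1) by (rule finite_linear_orders)
  have e0: "e0 (oriented_quiver p W T c) = (of_nat (card {r\<in>?L. ok c r}) / fact (card W) :: 'k)"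
    if c: "c \<in> ?D" for c
  proof -
    let ?Q = "oriented_quiver p W T c"
    have "tadpoles ?Q = {}"
    proof -
      have "tail ?Q (c u) \<noteq> head ?Q (c u)" if u: "u \<in> T" for u
      proof -
        obtain x y where xy: "c u = (u, x, y)" "ends u = {x, y}"
          using c u by (rule PiE_orientationsE)
        then have "x \<noteq> y" using two[OF u] by auto
        then show ?thesis using xy inj[OF u] by (auto simp: inj_on_def)
      qed
      then show ?thesis unfolding tadpoles_def oriented_quiver_sel(2) by blast
    qed
    moreover have "arcs_ends ?Q \<subseteq> r \<longleftrightarrow> ok c r" for r
      by (auto simp: ok_def arcs_ends_conv oriented_quiver_def case_prod_beta)
    moreover have "fin_digraph ?Q"
      using fin W c by (intro fin_digraph_oriented_quiver[where ends = ends]) auto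
    ultimately show ?thesis
      using e0_loopless[of ?Q] by simp
  qed
  have one: "card {c\<in>?D. ok c r} = 1" if r: "r \<in> ?L" for r
  proof -
    define S where
      "S = (\<lambda>u. {a \<in> edge_orientations ends u. (p (fst (snd a)), p (snd (snd a))) \<in> r})"
    have "card (S u) = 1" if u: "u \<in> T" for u
    proof -
      obtain x y where xy: "x \<noteq> y" "ends u = {x, y}"
        "edge_orientations ends u = {(u, x, y), (u, y, x)}"
        using edge_orientations_pair[of ends u] two[OF u] by metis
      have "p x \<noteq> p y" "p x \<in> W" "p y \<in> W"
        using inj[OF u] W[OF u] xy by (auto simp: inj_on_def)
      moreover have "total_on W r" "antisym r" using r by (auto simp: order_on_defs)
      ultimately have "(p x, p y) \<in> r \<longleftrightarrow> (p y, p x) \<notin> r"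
        unfolding total_on_def antisym_def by blast
      then have "S u = {(u, x, y)} \<or> S u = {(u, y, x)}"
        using xy unfolding S_def by auto
      then show ?thesis by auto
    qed
    moreover have "{c\<in>?D. ok c r} = Pi\<^sub>E T S"
      by (auto simp: ok_def S_def PiE_iff extensional_def)
    ultimately show ?thesis using fin(2) by (simp add: card_PiE)
  qed
  have "(\<Sum>c\<in>?D. card {r\<in>?L. ok c r}) = (\<Sum>r\<in>?L. card {c\<in>?D. ok c r})"
    by (rule sum_multicount_gen[OF finD finL]) auto
  also have "\<dots> = fact (card W)" using one card_linear_orders[OF fin(1)] by simp
  finally have "(\<Sum>c\<in>?D. of_nat (card {r\<in>?L. ok c r})) = (fact (card W) :: 'k)"
    by (simp flip: of_nat_sum)
  then show ?thesis
    by (simp add: e0 flip: sum_divide_distrib)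
qed

text \<open>
  Tadpoles and other edges are oriented independently.  An edge becomes a tadpole exactly when \<open>p\<close>
  identifies its two ends; its two orientations remain distinct arcs with their own parameters.
\<close>

lemma sum_e_quiver:
  fixes ends :: "'u \<Rightarrow> 'v set" and p :: "'v \<Rightarrow> 'w" and \<beta> :: "'u \<times> 'v \<times> 'v \<Rightarrow> 'k :: field_char_0"
  assumes fin: "finite W" "finite T" and two: "\<And>u. u \<in> T \<Longrightarrow> card (ends u) = 2"
    and W: "\<And>u x. u \<in> T \<Longrightarrow> x \<in> ends u \<Longrightarrow> p x \<in> W"
  shows "(\<Sum>c\<in>Pi\<^sub>E T (edge_orientations ends). e_quiver \<beta> (oriented_quiver p W T c)) =
    (\<Prod>u | u \<in> T \<and> \<not> inj_on p (ends u). 1 - beta_avg ends \<beta> u)"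
proof -
  let ?or = "edge_orientations ends"
  define L where "L = {u \<in> T. \<not> inj_on p (ends u)}"
  define N where "N = {u \<in> T. inj_on p (ends u)}"
  have LN: "L \<inter> N = {}" "T = L \<union> N" by (auto simp: L_def N_def)
  have split: "e_quiver \<beta> (oriented_quiver p W T c) =
      (\<Prod>u\<in>L. - ((\<beta> (restrict c L u) - 1) / 2)) * e0 (oriented_quiver p W N (restrict c N))"
    if c: "c \<in> Pi\<^sub>E T ?or" for c
  proof -
    let ?Q = "oriented_quiver p W T c"
    have injc: "inj_on c T" using c by (rule inj_on_orientation)
    have "tail ?Q (c u) = head ?Q (c u) \<longleftrightarrow> u \<in> L" if u: "u \<in> T" for u
    proof -
      obtain x y where xy: "c u = (u, x, y)" "ends u = {x, y}"
        using c u by (rule PiE_orientationsE)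
      then have "x \<noteq> y" using two[OF u] by auto
      then show ?thesis using xy u by (auto simp: inj_on_def L_def)
    qed
    then have tad: "tadpoles ?Q = c ` L" by (auto simp: tadpoles_def L_def)
    have "c ` T - c ` L = c ` N"
      using inj_on_image_set_diff[OF injc, of T L] LN by (simp add: Un_Diff Int_commute Diff_triv)
    then have "pruned ?Q = oriented_quiver p W N c"
      by (simp add: pruned_def tad) (simp add: oriented_quiver_def)
    also have "\<dots> = oriented_quiver p W N (restrict c N)"
      by (rule oriented_quiver_cong) simp
    finally show ?thesis
      using inj_on_subset[OF injc, of L] by (simp add: e_quiver_def tad prod.reindex L_def)
  qed
  have "(\<Sum>c\<in>Pi\<^sub>E T ?or. e_quiver \<beta> (oriented_quiver p W T c)) =
      (\<Sum>c\<in>Pi\<^sub>E L ?or. \<Prod>u\<in>L. - ((\<beta> (c u) - 1) / 2)) *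
      (\<Sum>c\<in>Pi\<^sub>E N ?or. e0 (oriented_quiver p W N c))"
    using sum_PiE_Un[OF LN(1), of "\<lambda>c. \<Prod>u\<in>L. - ((\<beta> (c u) - 1) / 2)"
        "\<lambda>c. e0 (oriented_quiver p W N c)" ?or]
    by (simp add: split flip: LN(2))
  also have "(\<Sum>c\<in>Pi\<^sub>E N ?or. e0 (oriented_quiver p W N c)) = (1 :: 'k)"
    using fin two W by (intro sum_e0_orientations) (auto simp: N_def)
  also have "(\<Sum>c\<in>Pi\<^sub>E L ?or. \<Prod>u\<in>L. - ((\<beta> (c u) - 1) / 2)) =
      (\<Prod>u\<in>L. \<Sum>a\<in>?or u. - ((\<beta> a - 1) / 2))"
    using fin(2) two
    by (intro prod_sum_PiE[symmetric]) (auto simp: L_def intro: finite_edge_orientations)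
  also have "\<dots> = (\<Prod>u\<in>L. 1 - beta_avg ends \<beta> u)"
  proof (rule prod.cong[OF refl])
    fix u assume "u \<in> L"
    then have "card (ends u) = 2" using two by (simp add: L_def)
    then obtain x y where "x \<noteq> y" "?or u = {(u, x, y), (u, y, x)}"
      by (rule edge_orientations_pair)
    then show "(\<Sum>a\<in>?or u. - ((\<beta> a - 1) / 2)) = 1 - beta_avg ends \<beta> u"
      by (simp add: beta_avg_def field_simps)
  qed
  finally show ?thesis by (simp add: L_def)
qed

section \<open>Components\<close>

definition edge_rel :: "('u \<Rightarrow> 'v set) \<Rightarrow> 'u set \<Rightarrow> 'v rel" where
  "edge_rel ends F = {(a, b). \<exists>u\<in>F. ends u = {a, b}}"

text \<open>
  The relation of lying in one component of the graph with edge set \<open>F\<close>, as a relation on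
  the whole type; vertices that meet no edge of \<open>F\<close> are related to themselves only.
\<close>

definition linked :: "('u \<Rightarrow> 'v set) \<Rightarrow> 'u set \<Rightarrow> 'v rel" where
  "linked ends F = (edge_rel ends F)\<^sup>*"

text \<open>Both ends of \<open>u\<close> lie in one component of the graph with edge set \<open>F\<close>.\<close>

definition spanned :: "('u \<Rightarrow> 'v set) \<Rightarrow> 'u set \<Rightarrow> 'u \<Rightarrow> bool" where
  "spanned ends F u \<longleftrightarrow> ends u \<times> ends u \<subseteq> linked ends F"

lemma multigraph_connected_linked:
  "multigraph_connected V F ends \<longleftrightarrow> V \<noteq> {} \<and> V \<times> V \<subseteq> linked ends F"
  by (auto simp: multigraph_connected_def linked_def edge_rel_def)

lemma equiv_linked: "equiv UNIV (linked ends F)"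
proof -
  have "sym (edge_rel ends F)" by (auto simp: edge_rel_def sym_def insert_commute)
  then show ?thesis
    unfolding linked_def by (intro equivI) (auto simp: refl_rtrancl sym_rtrancl trans_rtrancl)
qed

lemma linked_mono: "K \<subseteq> F \<Longrightarrow> linked ends K \<subseteq> linked ends F"
  unfolding linked_def edge_rel_def by (rule rtrancl_mono) blast

lemma linked_eq_iff:
  assumes "K \<subseteq> F" and two: "\<And>u. u \<in> F \<Longrightarrow> card (ends u) = 2"
  shows "linked ends K = linked ends F \<longleftrightarrow> (\<forall>u\<in>F - K. spanned ends K u)"
proof
  have "spanned ends F u" if u: "u \<in> F" for u
  proof -
    obtain x y where "ends u = {x, y}" using two[OF u] by (auto simp: card_2_iff)
    then have "(x, y) \<in> linked ends F" "(y, x) \<in> linked ends F"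
      using u by (auto simp: linked_def edge_rel_def insert_commute intro!: r_into_rtrancl)
    then show ?thesis
      using \<open>ends u = {x, y}\<close> by (auto simp: spanned_def linked_def)
  qed
  then show "\<forall>u\<in>F - K. spanned ends K u" if "linked ends K = linked ends F"
    using that by (simp add: spanned_def)
next
  assume sp: "\<forall>u\<in>F - K. spanned ends K u"
  have "edge_rel ends F \<subseteq> linked ends K"
  proof clarify
    fix a b assume "(a, b) \<in> edge_rel ends F"
    then obtain u where u: "u \<in> F" "ends u = {a, b}" by (auto simp: edge_rel_def)
    show "(a, b) \<in> linked ends K"
    proof (cases "u \<in> K")
      case True
      then have "(a, b) \<in> edge_rel ends K" using u by (auto simp: edge_rel_def)
      then show ?thesis unfolding linked_def by (rule r_into_rtrancl)
    next
      case False
      then have "ends u \<times> ends u \<subseteq> linked ends K" using u(1) sp by (simp add: spanned_def)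
      then show ?thesis unfolding u(2) by blast
    qed
  qed
  then have "linked ends F \<subseteq> linked ends K"
    unfolding linked_def by (rule rtrancl_subset_rtrancl)
  then show "linked ends K = linked ends F" using linked_mono[OF assms(1)] by blast
qed

lemma parcs_oriented_quiver:
  assumes "c \<in> Pi\<^sub>E F (edge_orientations ends)"
  shows "parcs (mk_symmetric (oriented_quiver (\<lambda>x. x) V F c)) = edge_rel ends F"
proof -
  have "{(tail (oriented_quiver (\<lambda>x. x) V F c) (c u), head (oriented_quiver (\<lambda>x. x) V F c) (c u)),
      (head (oriented_quiver (\<lambda>x. x) V F c) (c u), tail (oriented_quiver (\<lambda>x. x) V F c) (c u))} =
      {(a, b). ends u = {a, b}}" if u: "u \<in> F" for u
  proof -
    obtain x y where "c u = (u, x, y)" "ends u = {x, y}"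
      using assms u by (rule PiE_orientationsE)
    then show ?thesis by (auto simp: doubleton_eq_iff)
  qed
  then show ?thesis by (auto simp: parcs_mk_symmetric edge_rel_def)
qed

lemma reachable_oriented_quiver:
  assumes "\<And>u. u \<in> F \<Longrightarrow> ends u \<subseteq> V" and c: "c \<in> Pi\<^sub>E F (edge_orientations ends)"
  shows "v \<rightarrow>\<^sup>*\<^bsub>mk_symmetric (oriented_quiver (\<lambda>x. x) V F c)\<^esub> w \<longleftrightarrow>
    v \<in> V \<and> w \<in> V \<and> (v, w) \<in> linked ends F"
proof -
  have "(v, w) \<in> rtrancl_on V (edge_rel ends F) \<longleftrightarrow> v \<in> V \<and> w \<in> V \<and> (v, w) \<in> linked ends F"
    unfolding linked_def
  proof (intro iffI conjI)
    assume "v \<in> V \<and> w \<in> V \<and> (v, w) \<in> (edge_rel ends F)\<^sup>*"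
    then show "(v, w) \<in> rtrancl_on V (edge_rel ends F)"
      using assms(1) by (intro rtrancl_consistent_rtrancl_on) (auto simp: edge_rel_def)
  qed (auto dest: in_rtrancl_on_in_F rtrancl_on_rtranclI)
  then show ?thesis using parcs_oriented_quiver[OF c] by (simp add: reachable_def)
qed

text \<open>
  The component of \<open>v\<close> in the graph \<open>(V, F)\<close>.  Outside \<open>V\<close> the value is the empty set, which makes
  this equal, on the whole type, to \<^const>\<open>wcc_of\<close> of any orientation of \<open>(V, F)\<close>.
\<close>

definition component :: "('u \<Rightarrow> 'v set) \<Rightarrow> 'v set \<Rightarrow> 'u set \<Rightarrow> 'v \<Rightarrow> 'v set" where
  "component ends V F v = {w. v \<in> V \<and> w \<in> V \<and> (v, w) \<in> linked ends F}"

lemma inj_on_component_iff: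
  assumes "ends u \<subseteq> V" "card (ends u) = 2"
  shows "inj_on (component ends V F) (ends u) \<longleftrightarrow> \<not> spanned ends F u"
proof -
  obtain x y where xy: "x \<noteq> y" "ends u = {x, y}" using assms by (auto simp: card_2_iff)
  have eq: "component ends V F x = component ends V F y \<longleftrightarrow> (x, y) \<in> linked ends F"
    using assms(1) xy equiv_linked[of ends F]
    unfolding component_def equiv_def sym_def trans_def refl_on_def by blast
  moreover have "(x, y) \<in> linked ends F \<longleftrightarrow> spanned ends F u"
    using xy equiv_linked[of ends F]
    unfolding spanned_def equiv_def sym_def refl_on_def by auto
  ultimately show ?thesis using xy by (auto simp: inj_on_def)
qed

section \<open>The recursion for the orientation sum of \<open>\<omega>\<close>\<close>

lemma tadpole_free_multigraph_subset:
  "tadpole_free_multigraph V E ends \<Longrightarrow> F \<subseteq> E \<Longrightarrow> tadpole_free_multigraph V F ends"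
  by (auto simp: tadpole_free_multigraph_def intro: finite_subset)

lemma sum_Ori:
  "(\<Sum>G\<in>Ori V E ends. f G) =
    (\<Sum>c\<in>Pi\<^sub>E E (edge_orientations ends). f (oriented_quiver (\<lambda>x. x) V E c))"
proof -
  let ?mk = "oriented_quiver (\<lambda>x. x) V E" and ?C = "Pi\<^sub>E E (edge_orientations ends)"
  have "Ori V E ends = ?mk ` ?C"
  proof (intro equalityI subsetI)
    fix G assume "G \<in> Ori V E ends"
    then obtain c where "\<forall>u\<in>E. c u \<in> edge_orientations ends u" "G = ?mk c"
      by (auto simp: Ori_def oriented_quiver_def)
    then show "G \<in> ?mk ` ?C"
      by (intro image_eqI[of _ _ "restrict c E"]) (auto simp: oriented_quiver_def)
  qed (auto simp: Ori_def oriented_quiver_def)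
  moreover have "inj_on ?mk ?C"
  proof (rule inj_onI)
    fix c d assume cd: "c \<in> ?C" "d \<in> ?C" "?mk c = ?mk d"
    have "c u = d u" if "u \<in> E" for u
    proof -
      have "c u \<in> d ` E" using arg_cong[OF cd(3), of arcs] that by auto
      then obtain v where v: "v \<in> E" "c u = d v" by auto
      then show ?thesis
        using PiE_orientationsE[OF cd(1) that] PiE_orientationsE[OF cd(2) v(1)]
        by (metis prod.inject)
    qed
    then show "c = d" using cd by (auto intro: PiE_ext)
  qed
  ultimately show ?thesis by (simp add: sum.reindex)
qed

lemma contract_oriented_quiver:
  assumes G: "tadpole_free_multigraph V E ends" and F: "F \<subseteq> E"
    and c: "c \<in> Pi\<^sub>E E (edge_orientations ends)"
  shows "contract (oriented_quiver (\<lambda>x. x) V E c) (oriented_quiver (\<lambda>x. x) V F c) =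
    oriented_quiver (component ends V F) (component ends V F ` V) (E - F) c"
proof -
  let ?H = "oriented_quiver (\<lambda>x. x) V F c"
  have H: "?H = oriented_quiver (\<lambda>x. x) V F (restrict c F)"
    by (rule oriented_quiver_cong) simp
  have "restrict c F \<in> Pi\<^sub>E F (edge_orientations ends)" using c F by auto
  then have "v \<rightarrow>\<^sup>*\<^bsub>mk_symmetric ?H\<^esub> w \<longleftrightarrow> v \<in> V \<and> w \<in> V \<and> (v, w) \<in> linked ends F" for v w
    unfolding H using G F
    by (intro reachable_oriented_quiver) (auto simp: tadpole_free_multigraph_def)
  then have "wcc_of ?H v = component ends V F v" for v
    by (simp add: wcc_of_def component_def)
  then have wcc: "wcc_of ?H = component ends V F" by blast
  have "c ` E - c ` F = c ` (E - F)"
    using inj_on_image_set_diff[OF inj_on_orientation[OF c], of E F] F by auto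
  then show ?thesis
    by (auto simp: contract_def wcc) (auto simp: oriented_quiver_def fun_eq_iff)
qed

lemma sum_spanning_oriented_quiver:
  assumes G: "tadpole_free_multigraph V E ends" and c: "c \<in> Pi\<^sub>E E (edge_orientations ends)"
  shows "(\<Sum>H | spanning H (oriented_quiver (\<lambda>x. x) V E c). f H) =
    (\<Sum>F\<in>Pow E. f (oriented_quiver (\<lambda>x. x) V F c))"
proof -
  let ?Q = "\<lambda>F. oriented_quiver (\<lambda>x. x) V F c"
  have fd: "fin_digraph (?Q E)"
    using G c by (intro fin_digraph_oriented_quiver[where ends = ends])
      (auto simp: tadpole_free_multigraph_def)
  have arcs: "?Q E\<lparr>arcs := c ` F\<rparr> = ?Q F" for F by (simp add: oriented_quiver_def)
  have "{H. spanning H (?Q E)} = ?Q ` Pow E"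
    by (auto simp: spanning_iff[OF fd] subset_image_iff arcs)
      (metis arcs)
  moreover have "inj_on ?Q (Pow E)"
  proof (rule inj_onI)
    fix A B assume AB: "A \<in> Pow E" "B \<in> Pow E" "?Q A = ?Q B"
    then have "c ` A = c ` B" by (metis oriented_quiver_sel(2))
    then show "A = B" using inj_on_image_eq_iff[OF inj_on_orientation[OF c]] AB by auto
  qed
  ultimately show ?thesis by (simp add: sum.reindex)
qed

text \<open>
  The defining recursion of \<open>\<omega>\<close>, summed over all orientations.  For a fixed edge set \<open>F\<close> of
  the cut-subquiver, the orientations of \<open>F\<close> and of \<open>E - F\<close> are independent, and
  the contraction depends on \<open>F\<close> through its components but not on the orientation of \<open>F\<close>.
\<close>

lemma ori_omega_recursion:
  fixes \<beta> :: "'u \<times> 'v \<times> 'v \<Rightarrow> 'k :: field_char_0"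
  assumes G: "tadpole_free_multigraph V E ends"
  shows "(\<Sum>F\<in>Pow E. (\<Sum>H\<in>Ori V F ends. omega \<beta> H) *
      (\<Prod>u | u \<in> E - F \<and> spanned ends F u. 1 - beta_avg ends \<beta> u)) = (if E = {} then 1 else 0)"
proof -
  let ?or = "edge_orientations ends" and ?Q = "oriented_quiver (\<lambda>x. x) V"
  let ?R = "\<lambda>F. oriented_quiver (component ends V F) (component ends V F ` V) (E - F)"
  have fin: "finite V" "finite E" and two: "\<And>u. u \<in> E \<Longrightarrow> card (ends u) = 2"
    and sub: "\<And>u. u \<in> E \<Longrightarrow> ends u \<subseteq> V"
    using G by (auto simp: tadpole_free_multigraph_def)
  have summand: "(\<Sum>H\<in>Ori V F ends. omega \<beta> H) *
      (\<Prod>u | u \<in> E - F \<and> spanned ends F u. 1 - beta_avg ends \<beta> u) =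
      (\<Sum>c\<in>Pi\<^sub>E E ?or. omega \<beta> (?Q F c) * e_quiver \<beta> (contract (?Q E c) (?Q F c)))"
    if F: "F \<in> Pow E" for F
  proof -
    have "(\<Sum>c\<in>Pi\<^sub>E (E - F) ?or. e_quiver \<beta> (?R F c)) =
        (\<Prod>u | u \<in> E - F \<and> \<not> inj_on (component ends V F) (ends u). 1 - beta_avg ends \<beta> u)"
      using fin two sub by (intro sum_e_quiver) auto
    also have "\<dots> = (\<Prod>u | u \<in> E - F \<and> spanned ends F u. 1 - beta_avg ends \<beta> u)"
      using inj_on_component_iff[of ends _ V F] sub two by (intro prod.cong) auto
    finally have "(\<Sum>H\<in>Ori V F ends. omega \<beta> H) *
        (\<Prod>u | u \<in> E - F \<and> spanned ends F u. 1 - beta_avg ends \<beta> u) =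
        (\<Sum>c\<in>Pi\<^sub>E F ?or. omega \<beta> (?Q F c)) * (\<Sum>c\<in>Pi\<^sub>E (E - F) ?or. e_quiver \<beta> (?R F c))"
      by (simp add: sum_Ori)
    also have "\<dots> = (\<Sum>c\<in>Pi\<^sub>E (F \<union> (E - F)) ?or.
        omega \<beta> (?Q F (restrict c F)) * e_quiver \<beta> (?R F (restrict c (E - F))))"
      by (rule sum_PiE_Un[symmetric]) auto
    also have "F \<union> (E - F) = E" using F by auto
    also have "(\<Sum>c\<in>Pi\<^sub>E E ?or. omega \<beta> (?Q F (restrict c F)) * e_quiver \<beta> (?R F (restrict c (E - F)))) =
        (\<Sum>c\<in>Pi\<^sub>E E ?or. omega \<beta> (?Q F c) * e_quiver \<beta> (contract (?Q E c) (?Q F c)))"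
    proof (rule sum.cong[OF refl])
      fix c assume c: "c \<in> Pi\<^sub>E E ?or"
      have "?Q F (restrict c F) = ?Q F c" "?R F (restrict c (E - F)) = ?R F c"
        by (rule oriented_quiver_cong; simp)+
      then show "omega \<beta> (?Q F (restrict c F)) * e_quiver \<beta> (?R F (restrict c (E - F))) =
          omega \<beta> (?Q F c) * e_quiver \<beta> (contract (?Q E c) (?Q F c))"
        using contract_oriented_quiver[OF G _ c, of F] F by simp
    qed
    finally show ?thesis .
  qed
  have inner: "(\<Sum>F\<in>Pow E. omega \<beta> (?Q F c) * e_quiver \<beta> (contract (?Q E c) (?Q F c))) =
      (if E = {} then 1 else 0)" if c: "c \<in> Pi\<^sub>E E ?or" for c
  proof -
    have om: "is_omega \<beta> (omega \<beta> :: ('v, 'u \<times> 'v \<times> 'v) pre_digraph \<Rightarrow> 'k)"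
      by (rule is_omega_omega)
    have "fin_digraph (?Q E c)"
      using fin sub c by (intro fin_digraph_oriented_quiver[where ends = ends]) auto
    then have "(\<Sum>H | spanning H (?Q E c). omega \<beta> H * e_quiver \<beta> (contract (?Q E c) H)) =
        counit (?Q E c)"
      using om by (simp add: is_omega_def)
    then show ?thesis
      by (simp add: sum_spanning_oriented_quiver[OF G c] counit_def)
  qed
  have "(\<Sum>F\<in>Pow E. (\<Sum>H\<in>Ori V F ends. omega \<beta> H) *
      (\<Prod>u | u \<in> E - F \<and> spanned ends F u. 1 - beta_avg ends \<beta> u)) =
      (\<Sum>F\<in>Pow E. \<Sum>c\<in>Pi\<^sub>E E ?or. omega \<beta> (?Q F c) * e_quiver \<beta> (contract (?Q E c) (?Q F c)))"
    by (rule sum.cong[OF refl summand])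
  also have "\<dots> = (\<Sum>c\<in>Pi\<^sub>E E ?or. if E = {} then 1 else 0)"
    by (subst sum.swap) (simp add: inner)
  also have "\<dots> = (if E = {} then 1 else 0)" by simp
  finally show ?thesis .
qed

section \<open>Solving the recursion\<close>

text \<open>
  The alternating sum over all subsets of \<open>E\<close> with the same components as \<open>E\<close>, that is, over the
  subsets of full rank in the graphic matroid.
\<close>

definition rank_sum :: "('u \<Rightarrow> 'v set) \<Rightarrow> ('u \<Rightarrow> 'k :: comm_ring_1) \<Rightarrow> 'u set \<Rightarrow> 'k" where
  "rank_sum ends b E =
     (\<Sum>K | K \<subseteq> E \<and> linked ends K = linked ends E. (- 1) ^ card K * (\<Prod>u\<in>E - K. b u))"

lemma rank_sum_recursion:
  fixes b :: "'u \<Rightarrow> 'k :: comm_ring_1"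
  assumes fin: "finite E" and two: "\<And>u. u \<in> E \<Longrightarrow> card (ends u) = 2"
  shows "(\<Sum>F\<in>Pow E. rank_sum ends b F * (\<Prod>u | u \<in> E - F \<and> spanned ends F u. 1 - b u)) =
    (if E = {} then 1 else 0)"
proof -
  let ?g = "\<lambda>F. \<Prod>u | u \<in> E - F \<and> spanned ends F u. 1 - b u"
  \<comment> \<open>The sets \<open>F \<supseteq> K\<close> with the components of \<open>K\<close> are those between \<open>K\<close> and its closure \<open>K \<union> C\<close>.\<close>
  have interval: "(\<Sum>F | F \<in> Pow E \<and> K \<subseteq> F \<and> linked ends K = linked ends F.
      (\<Prod>u\<in>F - K. b u) * ?g F) = 1" (is "sum ?h ?I = 1") if K: "K \<in> Pow E" for K
  proof -
    define C where "C = {u \<in> E - K. spanned ends K u}"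
    have "sum ?h ?I = (\<Sum>X\<in>Pow C. (\<Prod>u\<in>X. b u) * (\<Prod>u\<in>C - X. 1 - b u))"
    proof (rule sum.reindex_bij_witness[of _ "\<lambda>X. K \<union> X" "\<lambda>F. F - K"])
      fix F assume F: "F \<in> ?I"
      show "K \<union> (F - K) = F" using F by auto
      have "\<forall>u\<in>F - K. spanned ends K u"
        using F two by (subst linked_eq_iff[symmetric]) auto
      then show "F - K \<in> Pow C" using F by (auto simp: C_def)
      have "{u \<in> E - F. spanned ends F u} = C - (F - K)"
        using F by (auto simp: C_def spanned_def)
      then show "(\<Prod>u\<in>F - K. b u) * (\<Prod>u\<in>C - (F - K). 1 - b u) = ?h F" by simp
    next
      fix X assume X: "X \<in> Pow C"
      show "K \<union> X - K = X" using X by (auto simp: C_def)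
      have "linked ends K = linked ends (K \<union> X)"
        using X K two by (subst linked_eq_iff) (auto simp: C_def)
      then show "K \<union> X \<in> ?I" using X K by (auto simp: C_def)
    qed
    also have "\<dots> = (\<Prod>u\<in>C. b u + (1 - b u))"
      using fin by (intro prod_add[symmetric]) (simp add: C_def)
    finally show ?thesis by simp
  qed
  have "(\<Sum>F\<in>Pow E. rank_sum ends b F * ?g F) =
      (\<Sum>F\<in>Pow E. \<Sum>K | K \<in> Pow E \<and> K \<subseteq> F \<and> linked ends K = linked ends F.
        (- 1) ^ card K * ((\<Prod>u\<in>F - K. b u) * ?g F))"
    unfolding rank_sum_def sum_distrib_right mult.assoc
    by (intro sum.cong refl) auto
  also have "\<dots> = (\<Sum>K\<in>Pow E. \<Sum>F | F \<in> Pow E \<and> K \<subseteq> F \<and> linked ends K = linked ends F.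
        (- 1) ^ card K * ((\<Prod>u\<in>F - K. b u) * ?g F))"
    using fin by (intro sum.swap_restrict) auto
  also have "\<dots> = (\<Sum>K\<in>Pow E. (- 1) ^ card K)"
    using interval by (intro sum.cong refl) (simp flip: sum_distrib_left)
  finally show ?thesis using sum_minus_one_power_card[OF fin] by simp
qed

theorem sum_omega_Ori:
  fixes \<beta> :: "'u \<times> 'v \<times> 'v \<Rightarrow> 'k :: field_char_0"
  assumes G: "tadpole_free_multigraph V E ends"
  shows "(\<Sum>G\<in>Ori V E ends. omega \<beta> G) = rank_sum ends (beta_avg ends \<beta>) E"
proof (rule subset_recursion_unique[where
      g = "\<lambda>A F. \<Prod>u | u \<in> A - F \<and> spanned ends F u. 1 - beta_avg ends \<beta> u"])
  show "finite E" using G by (simp add: tadpole_free_multigraph_def)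
next
  fix A assume "A \<subseteq> E"
  then have A: "tadpole_free_multigraph V A ends"
    using G by (rule tadpole_free_multigraph_subset[rotated])
  then have "finite A" "\<And>u. u \<in> A \<Longrightarrow> card (ends u) = 2"
    by (auto simp: tadpole_free_multigraph_def)
  then show "(\<Sum>F\<in>Pow A. (\<Sum>G\<in>Ori V F ends. omega \<beta> G) *
        (\<Prod>u | u \<in> A - F \<and> spanned ends F u. 1 - beta_avg ends \<beta> u)) =
      (\<Sum>F\<in>Pow A. rank_sum ends (beta_avg ends \<beta>) F *
        (\<Prod>u | u \<in> A - F \<and> spanned ends F u. 1 - beta_avg ends \<beta> u))"
    unfolding ori_omega_recursion[OF A] by (rule rank_sum_recursion[symmetric])
qed simp

section \<open>The connected part\<close>

lemma connected_oriented_quiver: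
  assumes "\<And>u. u \<in> E \<Longrightarrow> ends u \<subseteq> V" "c \<in> Pi\<^sub>E E (edge_orientations ends)"
  shows "connected (oriented_quiver (\<lambda>x. x) V E c) \<longleftrightarrow> multigraph_connected V E ends"
  using reachable_oriented_quiver[OF assms]
  by (auto simp: connected_def strongly_connected_def multigraph_connected_linked)

lemma multigraph_connected_mono:
  "multigraph_connected V F ends \<Longrightarrow> F \<subseteq> E \<Longrightarrow> multigraph_connected V E ends"
  using linked_mono[of F E ends] by (auto simp: multigraph_connected_linked)

lemma linked_eq_iff_multigraph_connected:
  assumes "tadpole_free_multigraph V E ends" "multigraph_connected V E ends" "F \<subseteq> E"
  shows "linked ends F = linked ends E \<longleftrightarrow> multigraph_connected V F ends"
proof
  assume "multigraph_connected V F ends"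
  then have "\<forall>u\<in>E - F. spanned ends F u"
    using assms(1) unfolding multigraph_connected_linked spanned_def tadpole_free_multigraph_def
    by blast
  then show "linked ends F = linked ends E"
    using assms by (subst linked_eq_iff) (auto simp: tadpole_free_multigraph_def)
qed (use assms(2) in \<open>auto simp: multigraph_connected_linked\<close>)

theorem sum_omega_c_Ori:
  fixes \<beta> :: "'u \<times> 'v \<times> 'v \<Rightarrow> 'k :: field_char_0"
  assumes G: "tadpole_free_multigraph V E ends"
  shows "(\<Sum>G\<in>Ori V E ends. omega_c \<beta> G) =
    (\<Sum>F | F \<subseteq> E \<and> multigraph_connected V F ends.
       (- 1) ^ card F * (\<Prod>u\<in>E - F. beta_avg ends \<beta> u))"
proof -
  have sub: "ends u \<subseteq> V" if "u \<in> E" for u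
    using G that by (simp add: tadpole_free_multigraph_def)
  have c: "(\<Sum>G\<in>Ori V E ends. omega_c \<beta> G) =
      (if multigraph_connected V E ends then \<Sum>G\<in>Ori V E ends. omega \<beta> G else 0)"
    by (simp add: sum_Ori omega_c_def connected_oriented_quiver[OF sub])
  show ?thesis
  proof (cases "multigraph_connected V E ends")
    case True
    have "{F. F \<subseteq> E \<and> multigraph_connected V F ends} =
        {F. F \<subseteq> E \<and> linked ends F = linked ends E}"
      using linked_eq_iff_multigraph_connected[OF G True] by blast
    then show ?thesis using True c sum_omega_Ori[OF G] by (simp add: rank_sum_def)
  next
    case False
    then have "{F. F \<subseteq> E \<and> multigraph_connected V F ends} = {}"
      using multigraph_connected_mono by blast
    then show ?thesis using False c by (simp del: Collect_empty_eq)
  qed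
qed

theorem theorem12p2:
  fixes V :: "'v set" and E :: "'u set" and ends :: "'u \<Rightarrow> 'v set"
    and \<beta> :: "'u \<times> 'v \<times> 'v \<Rightarrow> 'k :: field_char_0"
  assumes "tadpole_free_multigraph V E ends" and "V \<noteq> {}"
  shows "(\<Sum>G\<in>Ori V E ends. omega_c \<beta> G) =
      (\<Sum>F | F \<subseteq> E \<and> multigraph_connected V F ends.
         (- 1) ^ card F * (\<Prod>u\<in>E - F. beta_avg ends \<beta> u)) \<and>
    (\<forall>\<beta>' :: 'u \<times> 'v \<times> 'v \<Rightarrow> 'k. (\<forall>u\<in>E. beta_avg ends \<beta>' u = beta_avg ends \<beta> u) \<longrightarrow>
      (\<Sum>G\<in>Ori V E ends. omega_c \<beta>' G) = (\<Sum>G\<in>Ori V E ends. omega_c \<beta> G))"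
  by (simp add: sum_omega_c_Ori[OF assms(1)])

end
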